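(* Let $2\le k\le n-1$ and $c>0$. For every integer $l$ with $1\le l\le n-k$ there exists $\lambda\in\Gamma_k(n)$ with $\sigma_k(\lambda)=c$ such that $$\sigma_{k-1;i}(\lambda)>0\ \ (1\le i\le n),\qquad \sigma_{k+l-1}(\lambda)>0,\qquad \sigma_{k+l}(\lambda)<0,$$ and such that $\psi(y)=\frac12\sum_{i=1}^n\lambda_iy_i^2$ is a $(k+l-1)$-convex solution of the $k$-Hessian equation $S_k[\psi]=c$ which is not $(k+l)$-convex, and the linearized operator of $S_k[\,\cdot\,]$ at $\psi$, $\mathcal{L}_\psi=\sum_{i=1}^n\sigma_{k-1;i}(\lambda)\partial_i^2$, is uniformly elliptic. In addition, there exists $\lambda\in\Gamma_n(n)$ such that $\sigma_k(\lambda)=c$.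
   Context: For $\lambda\in\mathbb{R}^n$, $\sigma_j(\lambda)$ is the $j$-th elementary symmetric polynomial, $\sigma_0=1$, and $\sigma_{j;i}(\lambda)=\partial\sigma_{j+1}(\lambda)/\partial\lambda_i$, i.e. $\sigma_j$ evaluated with $\lambda_i$ replaced by $0$. $\Gamma_j(n)=\{\lambda\in\mathbb{R}^n:\sigma_i(\lambda)>0,\ 1\le i\le j\}$. For $u\in C^2$, $S_k[u]=\sigma_k$ of the eigenvalues of $D^2u$; $u$ is $j$-convex if these eigenvalues lie in $\Gamma_j(n)$ at every point. $\mathcal{L}_\psi$ is uniformly elliptic if all its coefficients $\sigma_{k-1;i}(\lambda)$ are positive. *)

theory Defs
  imports "HOL-Analysis.Analysis"
begin

definition partial_deriv :: "'n \<Rightarrow> (real ^ 'n \<Rightarrow> real) \<Rightarrow> real ^ 'n \<Rightarrow> real" where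
  "partial_deriv i u y = deriv (\<lambda>t. u (y + t *\<^sub>R axis i 1)) 0"

definition C1 :: "(real ^ 'n \<Rightarrow> real) \<Rightarrow> bool" where
  "C1 u \<longleftrightarrow> (\<forall>y. u differentiable (at y)) \<and> (\<forall>i. continuous_on UNIV (partial_deriv i u))"

definition C2 :: "(real ^ 'n \<Rightarrow> real) \<Rightarrow> bool" where
  "C2 u \<longleftrightarrow> C1 u \<and> (\<forall>i. C1 (partial_deriv i u))"

definition hessian :: "(real ^ 'n \<Rightarrow> real) \<Rightarrow> real ^ 'n \<Rightarrow> real ^ 'n ^ 'n" where
  "hessian u y = (\<chi> i j. partial_deriv i (partial_deriv j u) y)"

definition esym :: "nat \<Rightarrow> real ^ 'n \<Rightarrow> real" where
  "esym j x = (\<Sum>S | card S = j. \<Prod>i\<in>S. x $ i)"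

definition esym_del :: "nat \<Rightarrow> 'n \<Rightarrow> real ^ 'n \<Rightarrow> real" where
  "esym_del j i x = partial_deriv i (esym (Suc j)) x"

lemma esym_del_eq: "esym_del j i x = esym j (\<chi> m. if m = i then 0 else x $ m)"
proof -
  have der: "((\<lambda>t. \<Prod>m\<in>S. (x + t *\<^sub>R axis i 1) $ m) has_real_derivative
      (if i \<in> S then \<Prod>m\<in>S - {i}. x $ m else 0)) (at 0)" for S :: "'a set"
  proof (cases "i \<in> S")
    case True
    have "(\<Prod>m\<in>S. (x + t *\<^sub>R axis i 1) $ m) = (x $ i + t) * (\<Prod>m\<in>S - {i}. x $ m)" for t
      using True by (subst prod.remove[of S i]) (auto simp: axis_def intro!: prod.cong)
    then show ?thesis
      using True by (auto intro!: derivative_eq_intros)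
  next
    case False
    have "(\<Prod>m\<in>S. (x + t *\<^sub>R axis i 1) $ m) = (\<Prod>m\<in>S. x $ m)" for t
      using False by (auto simp: axis_def intro!: prod.cong)
    then show ?thesis
      using False by simp
  qed
  have "((\<lambda>t. esym (Suc j) (x + t *\<^sub>R axis i 1)) has_real_derivative
      (\<Sum>S | card S = Suc j. if i \<in> S then \<Prod>m\<in>S - {i}. x $ m else 0)) (at 0)"
    unfolding esym_def by (rule DERIV_sum) (rule der)
  then have "esym_del j i x = (\<Sum>S | card S = Suc j. if i \<in> S then \<Prod>m\<in>S - {i}. x $ m else 0)"
    unfolding esym_del_def partial_deriv_def by (rule DERIV_imp_deriv)
  also have "\<dots> = (\<Sum>S | card S = Suc j \<and> i \<in> S. \<Prod>m\<in>S - {i}. x $ m)"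
    by (rule sum.mono_neutral_cong_right) auto
  also have "\<dots> = (\<Sum>T | card T = j \<and> i \<notin> T. \<Prod>m\<in>T. x $ m)"
    by (rule sum.reindex_bij_witness[of _ "insert i" "\<lambda>S. S - {i}"]) (auto simp: insert_absorb)
  also have "\<dots> = (\<Sum>T | card T = j. \<Prod>m\<in>T. if m = i then 0 else x $ m)"
    by (rule sum.mono_neutral_cong_left) (auto intro!: prod.cong prod_zero)
  finally show ?thesis
    by (simp add: esym_def)
qed

definition Garding :: "nat \<Rightarrow> (real ^ 'n) set" where
  "Garding j = {x. \<forall>i. 1 \<le> i \<and> i \<le> j \<longrightarrow> 0 < esym i x}"

text \<open>The eigenvalues of a real symmetric matrix, listed with multiplicity. The order is
  irrelevant, since eigenvalue vectors are only used through symmetric functions. If the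
  characteristic polynomial does not split over the reals, the value is arbitrary.\<close>

definition eigenvalues :: "real ^ 'n ^ 'n \<Rightarrow> real ^ 'n" where
  "eigenvalues A = (SOME e. \<forall>s. det (mat s - A) = (\<Prod>i\<in>UNIV. s - e $ i))"

definition hessian_op :: "nat \<Rightarrow> (real ^ 'n \<Rightarrow> real) \<Rightarrow> real ^ 'n \<Rightarrow> real" where
  "hessian_op k u y = esym k (eigenvalues (hessian u y))"

definition j_convex :: "nat \<Rightarrow> (real ^ 'n \<Rightarrow> real) \<Rightarrow> bool" where
  "j_convex j u \<longleftrightarrow> C2 u \<and> (\<forall>y. eigenvalues (hessian u y) \<in> Garding j)"

text \<open>\<open>L\<close> is the linearized operator of \<open>F\<close> at \<open>u\<close>: the derivative of \<open>F\<close> at \<open>u\<close> in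
  every direction \<open>v\<close> of class \<open>C2\<close>, taken pointwise.\<close>

definition is_linearization ::
  "((real ^ 'n \<Rightarrow> real) \<Rightarrow> real ^ 'n \<Rightarrow> real) \<Rightarrow> (real ^ 'n \<Rightarrow> real) \<Rightarrow>
   ((real ^ 'n \<Rightarrow> real) \<Rightarrow> real ^ 'n \<Rightarrow> real) \<Rightarrow> bool" where
  "is_linearization F u L \<longleftrightarrow> (\<forall>v y. C2 v \<longrightarrow>
     ((\<lambda>t. F (\<lambda>z. u z + t * v z) y) has_real_derivative L v y) (at 0))"

definition diag_operator :: "real ^ 'n \<Rightarrow> (real ^ 'n \<Rightarrow> real) \<Rightarrow> real ^ 'n \<Rightarrow> real" where
  "diag_operator a v y = (\<Sum>i\<in>UNIV. a $ i * partial_deriv i (partial_deriv i v) y)"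

definition uniformly_elliptic :: "((real ^ 'n \<Rightarrow> real) \<Rightarrow> real ^ 'n \<Rightarrow> real) \<Rightarrow> bool" where
  "uniformly_elliptic L \<longleftrightarrow> (\<exists>a. L = diag_operator a \<and> (\<forall>i. 0 < a $ i))"

end

theory Submission
  imports Defs "HOL-Computational_Algebra.Polynomial"
begin

text \<open>For \<open>m = k + l\<close> and \<open>(n - m) / m < a < (n - m + 1) / (m - 1)\<close> the vector \<open>(1, \<dots>, 1, -a)\<close>
  satisfies all the strict inequalities. They survive a small perturbation that makes the entries
  distinct, and then a dilation normalizes \<open>\<sigma>\<^sub>k = c\<close>.

  Distinctness gives the linearization cheaply: the characteristic polynomial of a diagonal matrix
  with distinct entries changes sign around each entry, so by the intermediate value theorem that
  of any small perturbation, symmetric or not, still splits over the reals. Hence neither the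
  symmetry of second derivatives nor the spectral theorem is needed, and \<open>\<sigma>\<^sub>k\<close> of the eigenvalues can
  be differentiated as a coefficient of the characteristic polynomial.\<close>

section \<open>Lagrange interpolation and Vieta's formula\<close>

text \<open>Lagrange interpolation at the nodes \<open>0\<close>, ..., \<open>n\<close>: the weight
  \<open>w m\<close> is the \<open>j\<close>-th coefficient of the \<open>m\<close>-th basis
  polynomial, so it does not depend on \<open>p\<close>.\<close>

lemma coeff_eq_sum_poly_values:
  fixes n j :: nat
  obtains w :: "nat \<Rightarrow> real"
  where "\<And>p. degree p \<le> n \<Longrightarrow> coeff p j = (\<Sum>m\<le>n. w m * poly p (real m))"
proof
  define L :: "nat \<Rightarrow> real poly" where
    "L m = smult (1 / (\<Prod>i\<in>{..n} - {m}. real m - real i)) (\<Prod>i\<in>{..n} - {m}. [:- real i, 1:])" for m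
  have deg_L: "degree (L m) \<le> n" if "m \<le> n" for m
    using that by (simp add: L_def degree_prod_eq_sum_degree)
  have poly_L: "poly (L m) (real i) = (if i = m then 1 else 0)" if "m \<le> n" "i \<le> n" for m i
    using that by (auto simp: L_def poly_prod)
  fix p :: "real poly"
  assume p: "degree p \<le> n"
  have "p = (\<Sum>m\<le>n. smult (poly p (real m)) (L m))"
  proof (rule poly_eqI_degree[where A = "real ` {..n}"])
    show "poly p x = poly (\<Sum>m\<le>n. smult (poly p (real m)) (L m)) x" if x: "x \<in> real ` {..n}" for x
    proof -
      obtain i where i: "i \<le> n" "x = real i" using x by auto
      have "poly (\<Sum>m\<le>n. smult (poly p (real m)) (L m)) x
          = (\<Sum>m\<le>n. if m = i then poly p (real m) else 0)"
        unfolding poly_sum using i by (intro sum.cong) (auto simp: poly_L)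
      then show ?thesis using i by (simp add: sum.delta)
    qed
    have "degree (\<Sum>m\<le>n. smult (poly p (real m)) (L m)) \<le> n"
      by (rule degree_sum_le) (auto intro: order_trans[OF degree_smult_le] deg_L)
    then show "degree (\<Sum>m\<le>n. smult (poly p (real m)) (L m)) < card (real ` {..n})"
      by (simp add: card_image)
  qed (use p in \<open>simp add: card_image\<close>)
  then have "coeff p j = coeff (\<Sum>m\<le>n. smult (poly p (real m)) (L m)) j" by simp
  then show "coeff p j = (\<Sum>m\<le>n. coeff (L m) j * poly p (real m))"
    by (simp add: coeff_sum mult.commute)
qed

text \<open>Vieta's formula: taking the constant term from the factors indexed by \<open>X\<close>
  and the variable from the others gives degree \<open>CARD('n) - card X\<close>.\<close>

lemma coeff_prod_linear_esym:
  fixes e :: "real ^ 'n"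
  assumes "k \<le> CARD('n)"
  shows "coeff (\<Prod>i\<in>UNIV. [:- e $ i, 1:]) (CARD('n) - k) = (- 1) ^ k * esym k e"
proof -
  have pc: "(\<Prod>i\<in>X. [:- e $ i:]) = [:\<Prod>i\<in>X. - e $ i:]" for X :: "'n set"
    by (induction X rule: infinite_finite_induct) auto
  have "(\<Prod>i\<in>UNIV. [:- e $ i, 1:]) = (\<Prod>i\<in>UNIV. [:- e $ i:] + [:0, 1:])"
    by simp
  also have "\<dots> = (\<Sum>X\<in>UNIV. (\<Prod>i\<in>X. [:- e $ i:]) * (\<Prod>i\<in>UNIV - X. [:0, 1:]))"
    by (subst prod_add) auto
  also have "\<dots> = (\<Sum>X\<in>UNIV. monom (\<Prod>i\<in>X. - e $ i) (CARD('n) - card X))"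
    by (intro sum.cong) (auto simp: pc card_Diff_subset monom_altdef)
  finally have "coeff (\<Prod>i\<in>UNIV. [:- e $ i, 1:]) (CARD('n) - k)
      = (\<Sum>X\<in>UNIV. if CARD('n) - card X = CARD('n) - k then \<Prod>i\<in>X. - e $ i else 0)"
    by (simp add: coeff_sum)
  also have "\<dots> = (\<Sum>X | card X = k. \<Prod>i\<in>X. - e $ i)"
  proof (rule sum.mono_neutral_cong_right)
    \<comment> \<open>Subtraction is truncated, so the equivalence relies on both \<open>k\<close>
      and \<open>card X\<close> being at most \<open>CARD('n)\<close>.\<close>
    have "card X = k \<longleftrightarrow> CARD('n) - card X = CARD('n) - k" for X :: "'n set"
      using assms card_mono[of UNIV X] by auto
    then show "\<forall>X\<in>UNIV - {X :: 'n set. card X = k}.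
        (if CARD('n) - card X = CARD('n) - k then \<Prod>i\<in>X. - e $ i else 0) = 0"
      by auto
  qed auto
  also have "\<dots> = (\<Sum>X | card X = k. (- 1) ^ k * (\<Prod>i\<in>X. e $ i))"
    by (intro sum.cong) (auto simp: prod_uminus)
  finally show ?thesis
    by (simp add: esym_def sum_distrib_left)
qed

text \<open>By Vieta and Lagrange interpolation, \<open>esym k\<close> is a fixed linear functional of the polynomial
  function with the given roots; in particular it can be read off a characteristic polynomial.\<close>

lemma esym_eq_sum_values:
  assumes "k \<le> CARD('n::finite)"
  obtains w :: "nat \<Rightarrow> real"
  where "\<And>e :: real ^ 'n. esym k e = (\<Sum>m\<le>CARD('n). w m * (\<Prod>i\<in>UNIV. real m - e $ i))"
proof -
  obtain w where w: "\<And>p. degree p \<le> CARD('n) \<Longrightarrow>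
      coeff p (CARD('n) - k) = (\<Sum>m\<le>CARD('n). w m * poly p (real m))"
    using coeff_eq_sum_poly_values by blast
  show thesis
  proof (rule that[of "\<lambda>m. (- 1) ^ k * w m"])
    fix e :: "real ^ 'n"
    have "(- 1) ^ k * esym k e = (\<Sum>m\<le>CARD('n). w m * poly (\<Prod>i\<in>UNIV. [:- e $ i, 1:]) (real m))"
      using assms by (subst coeff_prod_linear_esym[symmetric], simp, subst w)
        (auto simp: degree_prod_eq_sum_degree)
    then have "(- 1) ^ k * ((- 1) ^ k * esym k e)
        = (- 1) ^ k * (\<Sum>m\<le>CARD('n). w m * (\<Prod>i\<in>UNIV. real m - e $ i))"
      by (simp add: poly_prod)
    then show "esym k e = (\<Sum>m\<le>CARD('n). (- 1) ^ k * w m * (\<Prod>i\<in>UNIV. real m - e $ i))"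
      by (simp add: sum_distrib_left mult.assoc flip: mult.assoc[of "(- 1) ^ k" "(- 1) ^ k"] power_mult_distrib)
  qed
qed

section \<open>Eigenvalues and characteristic polynomials\<close>

text \<open>One real splitting makes the choice in \<open>eigenvalues\<close> meaningful. The chosen
  vector may list the roots in another order than \<open>e\<close>, so only the products are
  compared.\<close>

lemma eigenvalues_prod:
  fixes A :: "real ^ 'n ^ 'n" and e :: "real ^ 'n"
  assumes "\<And>s. det (mat s - A) = (\<Prod>i\<in>UNIV. s - e $ i)"
  shows "det (mat s - A) = (\<Prod>i\<in>UNIV. s - eigenvalues A $ i)"
proof -
  have "\<exists>e :: real ^ 'n. \<forall>s. det (mat s - A) = (\<Prod>i\<in>UNIV. s - e $ i)"
    using assms by blast
  from someI_ex[OF this] show ?thesis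
    unfolding eigenvalues_def by blast
qed

definition diag_mat :: "real ^ 'n \<Rightarrow> real ^ 'n ^ 'n" where
  "diag_mat x = (\<chi> i j. if i = j then x $ i else 0)"

lemma det_mat_minus_diag_mat: "det (mat s - diag_mat x) = (\<Prod>i\<in>UNIV. s - x $ i)"
  by (subst det_diagonal) (auto simp: diag_mat_def mat_def)

text \<open>The vector chosen for \<open>diag_mat x\<close> may be a permutation of
  \<open>x\<close>, but \<open>esym k\<close> depends only on the values of the product polynomial,
  which agree.\<close>

lemma esym_eigenvalues_diag_mat:
  fixes x :: "real ^ 'n"
  assumes "k \<le> CARD('n)"
  shows "esym k (eigenvalues (diag_mat x)) = esym k x"
proof -
  obtain w where w: "\<And>e :: real ^ 'n. esym k e = (\<Sum>m\<le>CARD('n). w m * (\<Prod>i\<in>UNIV. real m - e $ i))"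
    using esym_eq_sum_values[OF assms] by blast
  show ?thesis
    using eigenvalues_prod[OF det_mat_minus_diag_mat, of _ x]
    by (simp only: w det_mat_minus_diag_mat)
qed

text \<open>The determinant is taken over the ring of real polynomials, so that degree arguments,
  root counting and \<open>poly_IVT\<close> apply.\<close>

definition char_poly :: "real ^ 'n ^ 'n \<Rightarrow> real poly" where
  "char_poly A = det (\<chi> i j. if i = j then [:- A $ i $ j, 1:] else [:- A $ i $ j:])"

lemma poly_char_poly: "poly (char_poly A) s = det (mat s - A)"
proof -
  have 1: "poly (of_int (sign p)) s = of_int (sign p)" for p :: "'a \<Rightarrow> 'a"
    by (simp add: sign_def)
  show ?thesis
    unfolding char_poly_def det_def
    by (auto simp: poly_sum poly_prod 1 mat_def intro!: sum.cong prod.cong)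
qed

text \<open>In the Leibniz formula only the identity reaches degree \<open>CARD('n)\<close>: its
  term is a product of monic linear factors, while any other permutation meets a constant
  off-diagonal entry.\<close>

lemma char_poly_monic:
  fixes A :: "real ^ 'n ^ 'n"
  shows "degree (char_poly A) \<le> CARD('n)" "coeff (char_poly A) CARD('n) = 1"
proof -
  let ?n = "CARD('n)"
  define M :: "'n \<Rightarrow> 'n \<Rightarrow> real poly" where
    "M i j = (if i = j then [:- A $ i $ j, 1:] else [:- A $ i $ j:])" for i j
  define R where "R = (\<Sum>p | p permutes (UNIV :: 'n set) \<and> p \<noteq> id. of_int (sign p) * (\<Prod>i\<in>UNIV. M i (p i)))"
  have "char_poly A = (\<Sum>p | p permutes (UNIV :: 'n set). of_int (sign p) * (\<Prod>i\<in>UNIV. M i (p i)))"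
    by (simp add: char_poly_def det_def M_def)
  also have "\<dots> = (\<Prod>i\<in>UNIV. M i i) + R"
    unfolding R_def
    by (subst sum.remove[of _ id]) (auto simp: sign_id permutes_id finite_permutations intro!: sum.cong)
  finally have eq: "char_poly A = (\<Prod>i\<in>UNIV. M i i) + R" .
  have degD: "degree (\<Prod>i\<in>UNIV. M i i) = ?n"
    by (simp add: M_def degree_prod_eq_sum_degree)
  moreover have "lead_coeff (\<Prod>i\<in>UNIV. M i i) = 1"
    by (subst lead_coeff_prod) (simp add: M_def)
  ultimately have coeffD: "coeff (\<Prod>i\<in>UNIV. M i i) ?n = 1" by simp
  have degR: "degree R < ?n"
    unfolding R_def
  proof (rule degree_sum_less)
    fix p assume p: "p \<in> {p. p permutes (UNIV :: 'n set) \<and> p \<noteq> id}"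
    then obtain j where j: "p j \<noteq> j" by (auto simp: fun_eq_iff)
    have "degree (of_int (sign p) * (\<Prod>i\<in>UNIV. M i (p i))) \<le> degree (\<Prod>i\<in>UNIV. M i (p i))"
      by (simp add: sign_def)
    also have "\<dots> \<le> (\<Sum>i\<in>UNIV. degree (M i (p i)))"
      using degree_prod_sum_le[of UNIV "\<lambda>i. M i (p i)"] by (simp add: comp_def)
    \<comment> \<open>Strict at the moved index \<open>j\<close>, whose entry is constant; every
      other entry has degree at most 1.\<close>
    also have "\<dots> < (\<Sum>i\<in>(UNIV :: 'n set). 1)"
      by (rule sum_strict_mono_ex1) (use j[symmetric] in \<open>auto simp: M_def\<close>)
    finally show "degree (of_int (sign p) * (\<Prod>i\<in>UNIV. M i (p i))) < ?n" by simp
  qed simp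
  show "degree (char_poly A) \<le> ?n"
    unfolding eq using degD degR by (intro degree_add_le) auto
  show "coeff (char_poly A) ?n = 1"
    unfolding eq using coeffD degR by (simp add: coeff_eq_0)
qed

text \<open>Two monic polynomials of degree \<open>CARD('n)\<close> that agree at
  \<open>CARD('n)\<close> distinct points coincide; injectivity of \<open>e\<close> supplies the
  points.\<close>

lemma det_mat_minus_eq_prod_roots:
  fixes A :: "real ^ 'n ^ 'n" and e :: "'n \<Rightarrow> real"
  assumes "inj e" "\<And>i. det (mat (e i) - A) = 0"
  shows "det (mat s - A) = (\<Prod>i\<in>UNIV. s - e i)"
proof -
  have deg: "degree (\<Prod>i\<in>UNIV. [:- e i, 1:]) = CARD('n)"
    by (simp add: degree_prod_eq_sum_degree)
  moreover have "lead_coeff (\<Prod>i\<in>UNIV. [:- e i, 1:]) = 1"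
    by (subst lead_coeff_prod) simp
  ultimately have lc: "coeff (\<Prod>i\<in>UNIV. [:- e i, 1:]) CARD('n) = 1" by simp
  have "char_poly A = (\<Prod>i\<in>UNIV. [:- e i, 1:])"
  proof (rule poly_eqI_degree_lead_coeff[where A = "range e" and n = "CARD('n)"])
    show "poly (char_poly A) z = poly (\<Prod>i\<in>UNIV. [:- e i, 1:]) z" if z: "z \<in> range e" for z
    proof -
      obtain i where i: "z = e i" using z by blast
      then have "(\<Prod>i\<in>UNIV. z - e i) = 0" by (intro prod_zero) auto
      then show ?thesis
        by (simp add: poly_char_poly poly_prod assms i)
    qed
  qed (use assms deg lc in \<open>simp_all add: char_poly_monic card_image\<close>)
  then show ?thesis
    by (simp add: poly_prod flip: poly_char_poly)
qed

section \<open>Perturbation of diagonal matrices with distinct entries\<close>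

lemma eventually_det_splits:
  fixes x :: "real ^ 'n" and B :: "real ^ 'n ^ 'n"
  assumes inj: "inj (($) x)"
  shows "eventually (\<lambda>t. \<exists>e :: real ^ 'n. \<forall>s.
    det (mat s - (diag_mat x + t *\<^sub>R B)) = (\<Prod>i\<in>UNIV. s - e $ i)) (nhds 0)"
proof -
  define q where "q t s = det (mat s - (diag_mat x + t *\<^sub>R B))" for t s
  \<comment> \<open>Half the least gap between entries bounds the radius \<open>d\<close>; the
    element \<open>1\<close> keeps \<open>G\<close> nonempty when there is only one index.\<close>
  define G where "G = insert 1 ((\<lambda>(i, j). \<bar>x $ i - x $ j\<bar>) ` {(i, j). i \<noteq> j})"
  define d where "d = Min G / 2"
  have "finite G" "G \<noteq> {}" "\<forall>g\<in>G. 0 < g"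
    using inj by (auto simp: G_def inj_def intro!: finite_imageI)
  then have d: "d > 0"
    by (simp add: d_def)
  have gap: "2 * d \<le> \<bar>x $ i - x $ j\<bar>" if "i \<noteq> j" for i j
    using that \<open>finite G\<close> by (auto simp: d_def G_def intro!: Min_le)
  have neg: "q 0 (x $ i - d) * q 0 (x $ i + d) < 0" for i
  proof -
    \<comment> \<open>Pairing the factors with the same \<open>j\<close> gives a difference of
      squares, which is negative for \<open>j = i\<close> and, by the gap bound, positive
      otherwise.\<close>
    have "q 0 (x $ i - d) * q 0 (x $ i + d) = (\<Prod>j\<in>UNIV. (x $ i - x $ j)\<^sup>2 - d\<^sup>2)"
      by (simp add: q_def det_mat_minus_diag_mat flip: prod.distrib)
        (simp add: algebra_simps power2_eq_square)
    also have "\<dots> = - d\<^sup>2 * (\<Prod>j\<in>UNIV - {i}. (x $ i - x $ j)\<^sup>2 - d\<^sup>2)"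
      by (subst prod.remove[of _ i]) auto
    also have "\<dots> < 0"
    proof -
      have "d\<^sup>2 < (x $ i - x $ j)\<^sup>2" if "j \<noteq> i" for j
        using gap[of i j] d that by (intro power2_strict_mono) auto
      then have "0 < (\<Prod>j\<in>UNIV - {i}. (x $ i - x $ j)\<^sup>2 - d\<^sup>2)"
        by (intro prod_pos) auto
      then show ?thesis
        using d by simp
    qed
    finally show ?thesis .
  qed
  have cont: "isCont (\<lambda>t. q t s) 0" for s
    unfolding q_def det_def by (intro continuous_intros)
  have "eventually (\<lambda>t. \<forall>i\<in>UNIV. q t (x $ i - d) * q t (x $ i + d) < 0) (nhds 0)"
  proof (intro eventually_ball_finite ballI)
    fix i
    have "isCont (\<lambda>t. q t (x $ i - d) * q t (x $ i + d)) 0"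
      by (intro continuous_intros cont)
    then have "((\<lambda>t. q t (x $ i - d) * q t (x $ i + d)) \<longlongrightarrow> q 0 (x $ i - d) * q 0 (x $ i + d)) (nhds 0)"
      unfolding isCont_def
      by (simp only: tendsto_at_iff_tendsto_nhds[of "\<lambda>t. q t (x $ i - d) * q t (x $ i + d)"])
    then show "eventually (\<lambda>t. q t (x $ i - d) * q t (x $ i + d) < 0) (nhds 0)"
      using neg by (rule order_tendstoD)
  qed simp
  then show ?thesis
  proof eventually_elim
    case (elim t)
    have "\<exists>r. x $ i - d < r \<and> r < x $ i + d \<and> q t r = 0" for i
      using poly_IVT[of "x $ i - d" "x $ i + d" "char_poly (diag_mat x + t *\<^sub>R B)"] elim d
      by (auto simp: poly_char_poly q_def)
    then obtain r where r: "\<And>i. x $ i - d < r i" "\<And>i. r i < x $ i + d" "\<And>i. q t (r i) = 0"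
      by metis
    \<comment> \<open>The open intervals of radius \<open>d\<close> around distinct entries are
      disjoint, so roots with different indices differ and there are \<open>CARD('n)\<close> of
      them.\<close>
    have "inj r"
    proof (rule injI, rule ccontr)
      fix i j assume "r i = r j" "i \<noteq> j"
      then show False
        using r(1,2)[of i] r(1,2)[of j] gap[of i j] by linarith
    qed
    then have "\<forall>s. det (mat s - (diag_mat x + t *\<^sub>R B)) = (\<Prod>i\<in>UNIV. s - (\<chi> i. r i) $ i)"
      using det_mat_minus_eq_prod_roots[of r] r(3) by (simp add: q_def)
    then show ?case by blast
  qed
qed

text \<open>A nontrivial permutation moves at least two indices, so its term in the Leibniz formula
  vanishes to second order.\<close>

lemma has_derivative_det_diag_perturb:
  fixes x :: "real ^ 'n" and B :: "real ^ 'n ^ 'n"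
  shows "((\<lambda>t. det (mat s - (diag_mat x + t *\<^sub>R B))) has_real_derivative
    (\<Sum>i\<in>UNIV. - B $ i $ i * (\<Prod>j\<in>UNIV - {i}. s - x $ j))) (at 0)"
proof -
  define M where "M t i j = (if i = j then s - x $ i else 0) - t * B $ i $ j" for t i j
  have M: "(mat s - (diag_mat x + t *\<^sub>R B)) $ i $ j = M t i j" for t i j
    by (simp add: M_def mat_def diag_mat_def)
  have der: "((\<lambda>t. of_int (sign p) * (\<Prod>i\<in>UNIV. M t i (p i))) has_real_derivative
      (if p = id then \<Sum>i\<in>UNIV. - B $ i $ i * (\<Prod>j\<in>UNIV - {i}. s - x $ j) else 0)) (at 0)"
    if p: "p permutes (UNIV :: 'n set)" for p
  proof -
    have "((\<lambda>t. M t i (p i)) has_real_derivative - B $ i $ p i) (at 0)" for i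
      unfolding M_def by (auto intro!: derivative_eq_intros)
    then have *: "((\<lambda>t. of_int (sign p) * (\<Prod>i\<in>UNIV. M t i (p i))) has_real_derivative
        of_int (sign p) * (\<Sum>i\<in>UNIV. - B $ i $ p i * (\<Prod>j\<in>UNIV - {i}. M 0 j (p j)))) (at 0)"
      by (intro DERIV_cmult has_field_derivative_prod)
    show ?thesis
    proof (cases "p = id")
      case True
      then show ?thesis using * by (simp add: M_def sign_id)
    next
      case False
      then obtain a where a: "p a \<noteq> a" by (auto simp: fun_eq_iff)
      then have pa: "p (p a) \<noteq> p a"
        using permutes_inj[OF p] by (simp add: inj_eq)
      have "(\<Prod>j\<in>UNIV - {i}. M 0 j (p j)) = 0" for i
      proof -
        obtain j where "j \<noteq> i" "p j \<noteq> j"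
          using a pa by metis
        then show ?thesis
          by (intro prod_zero) (auto simp: M_def intro!: bexI[of _ j])
      qed
      with * False show ?thesis by (simp only: mult_zero_right sum.neutral_const if_False)
    qed
  qed
  have "((\<lambda>t. \<Sum>p | p permutes (UNIV :: 'n set). of_int (sign p) * (\<Prod>i\<in>UNIV. M t i (p i))) has_real_derivative
      (\<Sum>p | p permutes (UNIV :: 'n set). if p = id then \<Sum>i\<in>UNIV. - B $ i $ i * (\<Prod>j\<in>UNIV - {i}. s - x $ j) else 0)) (at 0)"
    by (rule DERIV_sum) (use der in auto)
  then show ?thesis
    unfolding det_def M by (simp add: finite_permutations permutes_id)
qed

text \<open>Near \<open>t = 0\<close> the characteristic polynomial splits, so the function is a
  fixed linear combination of determinants, whose derivatives are known.\<close>

lemma esym_eigenvalues_perturb: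
  fixes x :: "real ^ 'n" and B :: "real ^ 'n ^ 'n"
  assumes inj: "inj (($) x)" and k: "Suc k \<le> CARD('n)"
  shows "((\<lambda>t. esym (Suc k) (eigenvalues (diag_mat x + t *\<^sub>R B))) has_real_derivative
    (\<Sum>i\<in>UNIV. esym_del k i x * B $ i $ i)) (at 0)"
proof -
  obtain w where w: "\<And>e :: real ^ 'n. esym (Suc k) e = (\<Sum>m\<le>CARD('n). w m * (\<Prod>i\<in>UNIV. real m - e $ i))"
    using esym_eq_sum_values[OF k] by blast
  \<comment> \<open>Differentiating the same combination along a coordinate axis expresses
    \<open>esym_del\<close> through the weights \<open>w\<close>, so the two derivatives match term
    by term.\<close>
  have del: "esym_del k i x = (\<Sum>m\<le>CARD('n). w m * - (\<Prod>j\<in>UNIV - {i}. real m - x $ j))" for i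
  proof -
    have *: "((\<lambda>t. \<Prod>j\<in>UNIV. real m - (x + t *\<^sub>R axis i 1) $ j) has_real_derivative
        - (\<Prod>j\<in>UNIV - {i}. real m - x $ j)) (at 0)" for m
    proof -
      have "(\<Prod>j\<in>UNIV. real m - (x + t *\<^sub>R axis i 1) $ j)
          = (real m - x $ i - t) * (\<Prod>j\<in>UNIV - {i}. real m - x $ j)" for t
        by (subst prod.remove[of _ i]) (auto simp: axis_def intro!: prod.cong)
      then show ?thesis
        by (auto intro!: derivative_eq_intros)
    qed
    show ?thesis
      unfolding esym_del_def partial_deriv_def w
      by (intro DERIV_imp_deriv DERIV_sum DERIV_cmult *)
  qed
  have "((\<lambda>t. \<Sum>m\<le>CARD('n). w m * det (mat (real m) - (diag_mat x + t *\<^sub>R B))) has_real_derivative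
      (\<Sum>m\<le>CARD('n). w m * (\<Sum>i\<in>UNIV. - B $ i $ i * (\<Prod>j\<in>UNIV - {i}. real m - x $ j)))) (at 0)"
    by (intro DERIV_sum DERIV_cmult has_derivative_det_diag_perturb)
  also have "(\<Sum>m\<le>CARD('n). w m * (\<Sum>i\<in>UNIV. - B $ i $ i * (\<Prod>j\<in>UNIV - {i}. real m - x $ j)))
      = (\<Sum>i\<in>UNIV. esym_del k i x * B $ i $ i)"
    unfolding del sum_distrib_left sum_distrib_right
    by (subst sum.swap) (simp add: mult_ac)
  finally have "((\<lambda>t. \<Sum>m\<le>CARD('n). w m * det (mat (real m) - (diag_mat x + t *\<^sub>R B))) has_real_derivative
      (\<Sum>i\<in>UNIV. esym_del k i x * B $ i $ i)) (at 0)" .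
  \<comment> \<open>\<open>eigenvalues\<close> is controlled only where the characteristic
    polynomial splits; equality near \<open>t = 0\<close> is enough for the derivative
    there.\<close>
  moreover have "eventually (\<lambda>t. esym (Suc k) (eigenvalues (diag_mat x + t *\<^sub>R B))
      = (\<Sum>m\<le>CARD('n). w m * det (mat (real m) - (diag_mat x + t *\<^sub>R B)))) (nhds 0)"
    using eventually_det_splits[OF inj, of B]
  proof eventually_elim
    case (elim t)
    then obtain e :: "real ^ 'n" where
      "\<And>s. det (mat s - (diag_mat x + t *\<^sub>R B)) = (\<Prod>i\<in>UNIV. s - e $ i)" by blast
    from eigenvalues_prod[OF this] show ?case
      by (simp only: w)
  qed
  ultimately show ?thesis
    by (subst DERIV_cong_ev[OF refl _ refl])
qed

section \<open>Quadratic functions: Hessian and linearization\<close>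

text \<open>\<open>partial_deriv\<close> is a \<open>deriv\<close>, which is informative only where
  a derivative exists; the chain rule provides one along the axis.\<close>

lemma has_derivative_along_axis:
  fixes u :: "real ^ 'n \<Rightarrow> real"
  assumes "u differentiable (at y)"
  shows "((\<lambda>t. u (y + t *\<^sub>R axis i 1)) has_real_derivative partial_deriv i u y) (at 0)"
proof -
  have "(u \<circ> (\<lambda>t. y + t *\<^sub>R axis i 1)) differentiable (at 0)"
    by (rule differentiable_chain_at) (use assms in \<open>auto intro!: derivative_intros\<close>)
  then show ?thesis
    unfolding partial_deriv_def DERIV_deriv_iff_real_differentiable by (simp add: comp_def)
qed

lemma partial_deriv_add_cmult:
  fixes u v :: "real ^ 'n \<Rightarrow> real"
  assumes "u differentiable (at y)" "v differentiable (at y)"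
  shows "partial_deriv i (\<lambda>z. u z + t * v z) y = partial_deriv i u y + t * partial_deriv i v y"
  unfolding partial_deriv_def[of i "\<lambda>z. u z + t * v z"]
  by (intro DERIV_imp_deriv DERIV_add DERIV_cmult has_derivative_along_axis assms)

text \<open>The \<psi> of the theorem, with the body written as there so that it can be folded. The
  factor 1/2 makes the Hessian \<open>diag_mat x\<close>.\<close>

definition quad :: "real ^ 'n \<Rightarrow> real ^ 'n \<Rightarrow> real" where
  "quad x = (\<lambda>y. 1 / 2 * (\<Sum>i\<in>UNIV. x $ i * (y $ i)\<^sup>2))"

lemma differentiable_nth [derivative_intros]: "(\<lambda>y :: real ^ 'n. y $ i) differentiable F"
  by (intro bounded_linear_imp_differentiable bounded_linear_vec_nth)

lemma partial_deriv_quad: "partial_deriv i (quad x) = (\<lambda>y. x $ i * y $ i)"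
proof
  fix y
  have "((\<lambda>t. quad x (y + t *\<^sub>R axis i 1)) has_real_derivative
      1 / 2 * (\<Sum>j\<in>UNIV. if j = i then 2 * x $ i * y $ i else 0)) (at 0)"
    unfolding quad_def
    by (intro DERIV_cmult DERIV_sum) (auto simp: axis_def intro!: derivative_eq_intros)
  then show "partial_deriv i (quad x) y = x $ i * y $ i"
    unfolding partial_deriv_def by (simp add: DERIV_imp_deriv)
qed

lemma partial_deriv_linear:
  "partial_deriv i (\<lambda>y. a * y $ j) = (\<lambda>y. if i = j then a else 0)"
proof
  fix y
  have "((\<lambda>t. a * (y + t *\<^sub>R axis i 1) $ j) has_real_derivative (if i = j then a else 0)) (at 0)"
    by (auto simp: axis_def intro!: derivative_eq_intros)
  then show "partial_deriv i (\<lambda>y. a * y $ j) y = (if i = j then a else 0)"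
    unfolding partial_deriv_def by (rule DERIV_imp_deriv)
qed

lemma C2_quad: "C2 (quad x)"
  unfolding C2_def C1_def partial_deriv_quad partial_deriv_linear
  by (auto simp: quad_def intro!: derivative_intros continuous_intros)

text \<open>Turns a variation in direction \<open>v\<close> into a perturbation of
  \<open>diag_mat x\<close>. Class \<open>C2\<close> justifies additivity of the partial derivatives
  at both orders.\<close>

lemma hessian_quad_add:
  assumes "C2 v"
  shows "hessian (\<lambda>z. quad x z + t * v z) y = diag_mat x + t *\<^sub>R hessian v y"
proof -
  have v: "v differentiable (at z)" "partial_deriv j v differentiable (at z)" for j z
    using assms by (auto simp: C2_def C1_def)
  have "partial_deriv j (\<lambda>z. quad x z + t * v z) = (\<lambda>z. x $ j * z $ j + t * partial_deriv j v z)" for j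
    by (rule ext, subst partial_deriv_add_cmult)
      (use C2_quad[of x] in \<open>auto simp: v C2_def C1_def partial_deriv_quad\<close>)
  moreover have "partial_deriv i (\<lambda>z. x $ j * z $ j + t * partial_deriv j v z) y
      = (if i = j then x $ j else 0) + t * partial_deriv i (partial_deriv j v) y" for i j
    by (subst partial_deriv_add_cmult) (auto simp: v partial_deriv_linear intro!: derivative_intros)
  ultimately show ?thesis
    by (simp add: hessian_def diag_mat_def vec_eq_iff)
qed

lemma hessian_quad: "hessian (quad x) y = diag_mat x"
  by (simp add: hessian_def diag_mat_def vec_eq_iff partial_deriv_quad partial_deriv_linear)

lemma hessian_op_quad:
  fixes x :: "real ^ 'n"
  shows "k \<le> CARD('n) \<Longrightarrow> hessian_op k (quad x) y = esym k x"
  by (simp add: hessian_op_def hessian_quad esym_eigenvalues_diag_mat)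

lemma j_convex_quad_iff:
  fixes x :: "real ^ 'n"
  shows "k \<le> CARD('n) \<Longrightarrow> j_convex k (quad x) \<longleftrightarrow> x \<in> Garding k"
  by (auto simp: j_convex_def C2_quad hessian_quad Garding_def esym_eigenvalues_diag_mat)

text \<open>The matrix derivative is applied at each fixed \<open>y\<close> to the Hessian of
  \<open>v\<close>; only its diagonal, the pure second derivatives, enters to first order.\<close>

lemma is_linearization_hessian_op_quad:
  fixes x :: "real ^ 'n"
  assumes "inj (($) x)" "1 \<le> k" "k \<le> CARD('n)"
  shows "is_linearization (hessian_op k) (quad x) (diag_operator (\<chi> i. esym_del (k - 1) i x))"
  unfolding is_linearization_def
proof (intro allI impI)
  fix v :: "real ^ 'n \<Rightarrow> real" and y
  assume "C2 v"
  moreover have "hessian v y $ i $ i = partial_deriv i (partial_deriv i v) y" for i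
    by (simp add: hessian_def)
  ultimately show "((\<lambda>t. hessian_op k (\<lambda>z. quad x z + t * v z) y) has_real_derivative
      diag_operator (\<chi> i. esym_del (k - 1) i x) v y) (at 0)"
    using esym_eigenvalues_perturb[OF assms(1), of "k - 1" "hessian v y"] assms(2,3)
    by (simp add: hessian_op_def hessian_quad_add diag_operator_def)
qed

section \<open>Symmetric functions of vectors with one exceptional entry\<close>

text \<open>Index sets are sorted by whether they contain \<open>i\<close>; those that do are
  \<open>insert i T\<close> with \<open>T\<close> avoiding \<open>i\<close>.\<close>

lemma esym_split:
  fixes x :: "real ^ 'n"
  shows "esym (Suc j) x = esym (Suc j) (\<chi> m. if m = i then 0 else x $ m)
    + x $ i * esym j (\<chi> m. if m = i then 0 else x $ m)"
proof -
  let ?y = "\<chi> m. if m = i then 0 else x $ m"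
  have "esym (Suc j) x = (\<Sum>S | card S = Suc j \<and> i \<notin> S. \<Prod>m\<in>S. x $ m)
      + (\<Sum>S | card S = Suc j \<and> i \<in> S. \<Prod>m\<in>S. x $ m)"
    unfolding esym_def by (subst sum.union_disjoint[symmetric]) (auto intro!: sum.cong)
  also have "(\<Sum>S | card S = Suc j \<and> i \<notin> S. \<Prod>m\<in>S. x $ m) = esym (Suc j) ?y"
    unfolding esym_def
    by (rule sum.mono_neutral_cong_left) (auto intro!: prod.cong prod_zero)
  also have "(\<Sum>S | card S = Suc j \<and> i \<in> S. \<Prod>m\<in>S. x $ m)
      = (\<Sum>T | card T = j \<and> i \<notin> T. x $ i * (\<Prod>m\<in>T. x $ m))"
    by (rule sum.reindex_bij_witness[of _ "insert i" "\<lambda>S. S - {i}"])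
      (auto simp: insert_absorb simp flip: prod.remove)
  also have "\<dots> = (\<Sum>T | card T = j. x $ i * (\<Prod>m\<in>T. ?y $ m))"
    by (rule sum.mono_neutral_cong_left) (auto intro!: prod.cong prod_zero)
  finally show ?thesis
    by (simp add: esym_def sum_distrib_left)
qed

lemma esym_indicator:
  fixes A :: "'n::finite set"
  shows "esym j (\<chi> m. if m \<in> A then 1 else 0) = real (card A choose j)"
proof -
  have "(\<Prod>m\<in>S. if m \<in> A then 1 else 0 :: real) = (if S \<subseteq> A then 1 else 0)" for S :: "'n set"
    by (auto intro!: prod.neutral prod_zero)
  then have "esym j (\<chi> m. if m \<in> A then 1 else 0) = (\<Sum>S | S \<subseteq> A \<and> card S = j. 1 :: real)"
    unfolding esym_def by (intro sum.mono_neutral_cong_right) auto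
  then show ?thesis
    by (simp add: n_subsets)
qed

lemma esym_scaleR: "esym j (t *\<^sub>R x) = t ^ j * esym j x"
  unfolding esym_def by (auto simp: sum_distrib_left prod.distrib intro!: sum.cong)

lemma esym_del_scaleR: "esym_del j i (t *\<^sub>R x) = t ^ j * esym_del j i x"
proof -
  have "(\<chi> m. if m = i then 0 else (t *\<^sub>R x) $ m) = t *\<^sub>R (\<chi> m. if m = i then 0 else x $ m)"
    by (simp add: vec_eq_iff)
  then show ?thesis
    by (simp only: esym_del_eq esym_scaleR)
qed

text \<open>Consecutive binomial coefficients have ratio \<open>(N - j) / (j + 1)\<close>; factoring
  out the positive one reduces the sign to a comparison of this ratio with \<open>a\<close>.\<close>

lemma binomial_Suc_diff:
  assumes "j \<le> N"
  shows "real (N choose Suc j) - a * real (N choose j)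
    = real (N choose j) * ((real N - real j) / real (Suc j) - a)"
proof -
  have "Suc j * (N choose Suc j) = (N - j) * (N choose j)"
    by (simp only: binomial_absorption binomial_absorb_comp)
  then have "real (Suc j) * real (N choose Suc j) = (real N - real j) * real (N choose j)"
    using assms by (metis of_nat_diff of_nat_mult)
  then have "real (N choose Suc j) = (real N - real j) * real (N choose j) / real (Suc j)"
    by (simp only: eq_divide_eq mult.commute[of "real (N choose Suc j)"]) simp
  then show ?thesis
    by (simp add: algebra_simps)
qed

lemma esym_one_negative:
  fixes i0 :: "'n::finite"
  shows "esym (Suc j) (\<chi> m. if m = i0 then - a else 1)
    = real ((CARD('n) - 1) choose Suc j) - a * real ((CARD('n) - 1) choose j)"
proof -
  have "(\<chi> m. if m = i0 then 0 else (\<chi> m. if m = i0 then - a else 1) $ m) = (\<chi> m. if m \<in> UNIV - {i0} then 1 else 0)"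
    by (simp add: vec_eq_iff)
  then show ?thesis
    by (subst esym_split[of _ _ i0]) (simp only: esym_indicator card_Diff_singleton UNIV_I, simp)
qed

text \<open>Deleting \<open>i0\<close> leaves \<open>CARD('n) - 1\<close> ones. Deleting another
  index leaves \<open>CARD('n) - 2\<close> ones and the entry \<open>- a\<close>, which is then
  split off.\<close>

lemma esym_del_one_negative:
  fixes i0 :: "'n::finite"
  shows "esym_del j i0 (\<chi> m. if m = i0 then - a else 1) = real ((CARD('n) - 1) choose j)"
    and "i \<noteq> i0 \<Longrightarrow> esym_del (Suc j) i (\<chi> m. if m = i0 then - a else 1)
      = real ((CARD('n) - 2) choose Suc j) - a * real ((CARD('n) - 2) choose j)"
proof -
  have "(\<chi> m. if m = i0 then 0 else (\<chi> m. if m = i0 then - a else 1) $ m) = (\<chi> m. if m \<in> UNIV - {i0} then 1 else 0)"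
    by (simp add: vec_eq_iff)
  then show "esym_del j i0 (\<chi> m. if m = i0 then - a else 1) = real ((CARD('n) - 1) choose j)"
    by (simp only: esym_del_eq esym_indicator card_Diff_singleton UNIV_I)
  assume i: "i \<noteq> i0"
  have "(\<chi> m. if m = i0 then 0 else (\<chi> m. if m = i then 0 else (\<chi> m. if m = i0 then - a else 1) $ m) $ m)
      = (\<chi> m. if m \<in> UNIV - {i, i0} then 1 else 0)"
    by (simp add: vec_eq_iff)
  moreover have "card (UNIV - {i, i0}) = CARD('n) - 2"
    using i by (subst card_Diff_subset) auto
  ultimately show "esym_del (Suc j) i (\<chi> m. if m = i0 then - a else 1)
      = real ((CARD('n) - 2) choose Suc j) - a * real ((CARD('n) - 2) choose j)"
    using i unfolding esym_del_eq
    by (subst esym_split[of _ _ i0]) (simp only: esym_indicator, simp)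
qed

section \<open>Vectors between consecutive Garding cones\<close>

lemma isCont_esym: "isCont f z \<Longrightarrow> isCont (\<lambda>t. esym j (f t)) z"
  unfolding esym_def by (intro continuous_intros)

lemma isCont_esym_del: "isCont f z \<Longrightarrow> isCont (\<lambda>t. esym_del j i (f t)) z"
  unfolding esym_del_eq esym_def vec_lambda_beta
proof (intro continuous_sum continuous_prod)
  show "isCont (\<lambda>t. if m = i then 0 else f t $ m) z" if "isCont f z" for m
    using that by (cases "m = i") (auto intro!: continuous_intros)
qed

lemma exists_between_Garding_cones:
  assumes "2 \<le> k" "k < m" "m \<le> CARD('n::finite)"
  obtains x :: "real ^ 'n"
  where "x \<in> Garding (m - 1)" "esym m x < 0" "\<And>i. 0 < esym_del (k - 1) i x"
proof -
  let ?n = "CARD('n)"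
  \<comment> \<open>\<open>q j\<close> is the threshold for \<open>a\<close> at which the
    \<open>j\<close>-th symmetric function of the vector changes sign. As \<open>q\<close>
    decreases, placing \<open>a\<close> between \<open>q m\<close> and \<open>q (m - 1)\<close>
    fixes all signs up to \<open>m\<close>.\<close>
  define q where "q j = (real ?n - real j) / real j" for j
  have q_Suc: "q (Suc j) = (real (?n - 1) - real j) / real (Suc j)" for j
    using assms by (simp add: q_def of_nat_diff)
  have q_mono: "q j \<le> q i" if "1 \<le> i" "i \<le> j" for i j
    using that by (simp add: q_def diff_divide_distrib divide_left_mono)
  have "q m < q (m - 1)"
    using assms by (simp add: q_def diff_divide_distrib divide_strict_left_mono)
  then obtain a where a: "q m < a" "a < q (m - 1)"
    using dense by blast
  have "0 \<le> q m"
    using assms by (simp add: q_def)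
  then have "0 < a" using a by simp
  fix i0 :: 'n
  define x :: "real ^ 'n" where "x = (\<chi> m. if m = i0 then - a else 1)"
  have esym_x: "esym (Suc j) x = real ((?n - 1) choose j) * (q (Suc j) - a)" if "j < ?n" for j
    unfolding x_def esym_one_negative q_Suc using that by (intro binomial_Suc_diff) simp
  show thesis
  proof (rule that)
    show "x \<in> Garding (m - 1)"
      unfolding Garding_def
    proof (intro CollectI allI impI, elim conjE)
      fix i assume i: "1 \<le> i" "i \<le> m - 1"
      then have "a < q i" using q_mono[of i "m - 1"] a by linarith
      then show "0 < esym i x"
        using esym_x[of "i - 1"] i assms by simp
    qed
    show "esym m x < 0"
      using esym_x[of "m - 1"] a assms by (simp add: mult_pos_neg)
    fix i
    show "0 < esym_del (k - 1) i x"
    proof (cases "i = i0")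
      case True
      then show ?thesis
        using assms by (simp add: x_def esym_del_one_negative)
    next
      case False
      \<comment> \<open>For \<open>i \<noteq> i0\<close> the threshold has denominator
        \<open>k - 1\<close> in place of the \<open>k\<close> in \<open>q k\<close>, so it is no
        smaller than \<open>q k\<close>, and \<open>k \<le> m - 1\<close> gives
        \<open>a < q k\<close>.\<close>
      have "a < q k" using q_mono[of k "m - 1"] a assms by linarith
      also have "q k \<le> (real ?n - real k) / (real k - 1)"
        unfolding q_def using assms by (intro divide_left_mono) auto
      also have "\<dots> = (real (?n - 2) - real (k - 2)) / real (Suc (k - 2))"
        using assms by (simp add: of_nat_diff Suc_diff_le)
      finally have "0 < real ((?n - 2) choose (k - 2))
          * ((real (?n - 2) - real (k - 2)) / real (Suc (k - 2)) - a)"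
        using assms by (intro mult_pos_pos) auto
      also have "\<dots> = esym_del (Suc (k - 2)) i x"
        unfolding x_def using False assms
        by (subst esym_del_one_negative) (auto simp: binomial_Suc_diff)
      also have "Suc (k - 2) = k - 1" using assms by simp
      finally show ?thesis .
    qed
  qed
qed

text \<open>The finitely many strict inequalities are open conditions and persist for small
  \<open>t\<close>, while the perturbation separates equal entries.\<close>

lemma exists_distinct_between_Garding_cones:
  assumes "2 \<le> k" "k < m" "m \<le> CARD('n::finite)"
  obtains x :: "real ^ 'n"
  where "inj (($) x)" "x \<in> Garding (m - 1)" "esym m x < 0" "\<And>i. 0 < esym_del (k - 1) i x"
proof -
  obtain b :: "real ^ 'n" where b: "b \<in> Garding (m - 1)" "esym m b < 0" "\<And>i. 0 < esym_del (k - 1) i b"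
    using exists_between_Garding_cones[OF assms] by blast
  obtain f :: "'n \<Rightarrow> nat" where f: "inj f"
    using finite_imp_inj_to_nat_seg[of "UNIV :: 'n set"] by auto
  \<comment> \<open>The direction has pairwise distinct entries, so ties in \<open>b\<close> are
    broken for every \<open>t > 0\<close>; entries of \<open>b\<close> that differ stay different
    for small \<open>t\<close> by continuity. Hence the one-sided filter at 0.\<close>
  define x where "x t = b + t *\<^sub>R (\<chi> i. real (f i))" for t
  have x0: "x 0 = b" by (simp add: x_def)
  have cont: "isCont x 0"
    unfolding x_def by (intro continuous_intros)
  have pos: "eventually (\<lambda>t. 0 < g t) (at_right 0)" if "isCont g 0" "0 < g 0" for g :: "real \<Rightarrow> real"
  proof -
    have "(g \<longlongrightarrow> g 0) (at_right 0)"
      using that(1) unfolding isCont_def by (rule tendsto_within_subset) simp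
    then show ?thesis
      using that(2) by (rule order_tendstoD)
  qed
  have "eventually (\<lambda>t. \<forall>i\<in>{1..m - 1}. 0 < esym i (x t)) (at_right 0)"
    using b by (intro eventually_ball_finite ballI pos isCont_esym cont) (auto simp: x0 Garding_def)
  moreover have "eventually (\<lambda>t. 0 < - esym m (x t)) (at_right 0)"
    using b by (intro pos continuous_minus isCont_esym cont) (simp add: x0)
  moreover have "eventually (\<lambda>t. \<forall>i\<in>UNIV. 0 < esym_del (k - 1) i (x t)) (at_right 0)"
    using b by (intro eventually_ball_finite ballI pos isCont_esym_del cont) (auto simp: x0)
  moreover have "eventually (\<lambda>t. \<forall>i\<in>UNIV. \<forall>j\<in>UNIV. i \<noteq> j \<longrightarrow> x t $ i \<noteq> x t $ j) (at_right 0)"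
  proof (intro eventually_ball_finite ballI)
    fix i j :: 'n
    show "eventually (\<lambda>t. i \<noteq> j \<longrightarrow> x t $ i \<noteq> x t $ j) (at_right 0)"
    proof (cases "b $ i = b $ j")
      case True
      have "x t $ i \<noteq> x t $ j" if "0 < t" "i \<noteq> j" for t
        using that f True by (simp add: x_def inj_eq)
      then show ?thesis
        using eventually_at_right_less[of 0] by (auto elim: eventually_mono)
    next
      case False
      have "isCont (\<lambda>t. \<bar>x t $ i - x t $ j\<bar>) 0"
        by (intro continuous_intros cont)
      then have "eventually (\<lambda>t. 0 < \<bar>x t $ i - x t $ j\<bar>) (at_right 0)"
        using False by (intro pos) (auto simp: x0)
      then show ?thesis by eventually_elim simp
    qed
  qed auto
  ultimately have "eventually (\<lambda>t. inj (($) (x t)) \<and> x t \<in> Garding (m - 1) \<and> esym m (x t) < 0 \<and>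
      (\<forall>i. 0 < esym_del (k - 1) i (x t))) (at_right 0)"
    proof eventually_elim
    case (elim t)
    have "inj (($) (x t))"
    proof (rule injI, rule ccontr)
      fix i j assume "x t $ i = x t $ j" "i \<noteq> j"
      with elim(4) show False by simp
    qed
    moreover have "x t \<in> Garding (m - 1)"
      using elim(1) by (simp add: Garding_def)
    moreover have "esym m (x t) < 0"
      using elim(2) by simp
    ultimately show ?case
      using elim(3) by simp
  qed
  from eventually_happens'[OF trivial_limit_at_right_real this] show thesis
    using that by blast
qed

section \<open>Normalization by dilation and conclusion\<close>

theorem theorem2p8:
  fixes k :: nat and c :: real
  assumes "2 \<le> k" and "k \<le> CARD('n::finite) - 1" and "0 < c"
  shows "(\<forall>l. 1 \<le> l \<and> l \<le> CARD('n) - k \<longrightarrow>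
           (\<exists>lam \<in> (Garding k :: (real ^ 'n) set).
              let \<psi> = (\<lambda>y :: real ^ 'n. 1 / 2 * (\<Sum>i\<in>UNIV. lam $ i * (y $ i)\<^sup>2));
                  L = diag_operator (\<chi> i. esym_del (k - 1) i lam)
              in esym k lam = c \<and>
                 (\<forall>i. 0 < esym_del (k - 1) i lam) \<and>
                 0 < esym (k + l - 1) lam \<and>
                 esym (k + l) lam < 0 \<and>
                 j_convex (k + l - 1) \<psi> \<and>
                 (\<forall>y. hessian_op k \<psi> y = c) \<and>
                 \<not> j_convex (k + l) \<psi> \<and>
                 is_linearization (hessian_op k) \<psi> L \<and>
                 uniformly_elliptic L)) \<and>
         (\<exists>lam \<in> (Garding CARD('n) :: (real ^ 'n) set). esym k lam = c)"
proof (intro conjI allI impI, elim conjE)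
  fix l :: nat
  assume l: "1 \<le> l" "l \<le> CARD('n) - k"
  let ?m = "k + l"
  have m: "k < ?m" "?m \<le> CARD('n)"
    using l assms by auto
  obtain x :: "real ^ 'n" where x: "inj (($) x)" "x \<in> Garding (?m - 1)" "esym ?m x < 0"
    "\<And>i. 0 < esym_del (k - 1) i x"
    using exists_distinct_between_Garding_cones[OF assms(1) m] by blast
  have k: "0 < esym k x"
    using x(2) l assms by (auto simp: Garding_def)
  \<comment> \<open>By homogeneity of degree \<open>k\<close>, this dilation factor gives
    \<open>esym k\<close> the value \<open>c\<close>; being positive, it preserves all the
    signs.\<close>
  define t where "t = root k (c / esym k x)"
  have t: "0 < t" "t ^ k = c / esym k x"
    using assms k by (auto simp: t_def real_root_pow_pos2)
  define lam where "lam = t *\<^sub>R x"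
  have esym: "esym k lam = c"
    using t k by (simp add: lam_def esym_scaleR)
  have inj: "inj (($) lam)"
    using x(1) t by (auto simp: lam_def inj_def)
  have G: "lam \<in> Garding (?m - 1)"
    using x(2) t by (simp add: lam_def Garding_def esym_scaleR)
  have neg: "esym ?m lam < 0"
    using x(3) t by (simp add: lam_def esym_scaleR mult_pos_neg)
  have pos: "0 < esym_del (k - 1) i lam" for i
    using x(4) t by (simp add: lam_def esym_del_scaleR)
  show "\<exists>lam \<in> (Garding k :: (real ^ 'n) set).
      let \<psi> = (\<lambda>y :: real ^ 'n. 1 / 2 * (\<Sum>i\<in>UNIV. lam $ i * (y $ i)\<^sup>2));
          L = diag_operator (\<chi> i. esym_del (k - 1) i lam)
      in esym k lam = c \<and>
         (\<forall>i. 0 < esym_del (k - 1) i lam) \<and>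
         0 < esym (k + l - 1) lam \<and>
         esym (k + l) lam < 0 \<and>
         j_convex (k + l - 1) \<psi> \<and>
         (\<forall>y. hessian_op k \<psi> y = c) \<and>
         \<not> j_convex (k + l) \<psi> \<and>
         is_linearization (hessian_op k) \<psi> L \<and>
         uniformly_elliptic L"
    unfolding Let_def quad_def[symmetric]
  proof (intro bexI[of _ lam] conjI allI pos neg esym)
    \<comment> \<open>Both follow from membership in \<open>Garding (k + l - 1)\<close>, because
      \<open>l \<ge> 1\<close> gives \<open>k \<le> k + l - 1\<close>.\<close>
    show "lam \<in> Garding k" "0 < esym (?m - 1) lam"
      using G l assms(1) by (auto simp: Garding_def)
    show "j_convex (?m - 1) (quad lam)"
      using G m by (subst j_convex_quad_iff) auto
    show "\<not> j_convex ?m (quad lam)"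
      using neg m by (subst j_convex_quad_iff) (auto simp: Garding_def intro!: exI[of _ ?m])
    show "hessian_op k (quad lam) y = c" for y
      using esym m by (subst hessian_op_quad) auto
    show "is_linearization (hessian_op k) (quad lam) (diag_operator (\<chi> i. esym_del (k - 1) i lam))"
      using inj m assms(1) by (intro is_linearization_hessian_op_quad) auto
    show "uniformly_elliptic (diag_operator (\<chi> i. esym_del (k - 1) i lam))"
      unfolding uniformly_elliptic_def
      by (intro exI[of _ "\<chi> i. esym_del (k - 1) i lam"]) (simp add: pos[simplified])
  qed
next
  \<comment> \<open>The all-ones vector is written as an indicator so that
    \<open>esym_indicator\<close> evaluates its symmetric functions as binomial coefficients,
    positive up to index \<open>CARD('n)\<close>.\<close>
  let ?one = "(\<chi> m. if m \<in> UNIV then 1 else 0) :: real ^ 'n"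
  define t where "t = root k (c / real (CARD('n) choose k))"
  have choose: "0 < real (CARD('n) choose k)"
    using assms by simp
  then have t: "0 < t" "t ^ k = c / real (CARD('n) choose k)"
    using assms by (auto simp: t_def real_root_pow_pos2)
  show "\<exists>lam \<in> (Garding CARD('n) :: (real ^ 'n) set). esym k lam = c"
  proof (rule bexI[of _ "t *\<^sub>R ?one"])
    show "esym k (t *\<^sub>R ?one) = c"
      unfolding esym_scaleR esym_indicator t(2) using choose by simp
    show "t *\<^sub>R ?one \<in> Garding CARD('n)"
      using t by (simp only: Garding_def mem_Collect_eq esym_scaleR esym_indicator) simp
  qed
qed

end
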